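(* Let $k$ be a field, let $I,J\ge 1$ and $t\ge 2$ be integers, and let $(a_{i,r})$, $1\le i\le IJ$, $1\le r\le t$, be non-negative integers. Let $A$ be the $IJ\times(t+1)$ matrix whose $i$-th row is $(1,a_{i,1},\ldots,a_{i,t})$, and let $\tilde A$ be the $IJ\times t$ matrix whose $i$-th row is $(1,a_{i,1},\ldots,a_{i,t-2},a_{i,t-1}+a_{i,t})$, i.e. the matrix obtained from $A$ by replacing its last two columns with their sum. Consider the $k$-algebra homomorphisms $$\phi: k[p_1,\ldots,p_{IJ}]\to k[\zeta_0,\ldots,\zeta_t],\qquad \phi(p_i)=\zeta_0\,\zeta_1^{a_{i,1}}\cdots\zeta_t^{a_{i,t}},$$ $$\psi: k[p_1,\ldots,p_{IJ}]\to k[\zeta_0,\ldots,\zeta_{t-1}],\qquad \psi(p_i)=\zeta_0\,\zeta_1^{a_{i,1}}\cdots\zeta_{t-2}^{a_{i,t-2}}\,\zeta_{t-1}^{a_{i,t-1}+a_{i,t}},$$ and $$\alpha: k[\zeta_0,\ldots,\zeta_t]\to k[\zeta_0,\ldots,\zeta_{t-1}],\qquad \alpha(\zeta_i)=\zeta_i \ (i\ne t),\quad \alpha(\zeta_t)=\zeta_{t-1},$$ which form a commutative diagram, $\psi=\alpha\circ\phi$. Then $$\mathcal{I}(\tilde A)=\mathcal{I}(A)+\phi^{-1}\big(\langle \zeta_{t-1}-\zeta_t\rangle\big),$$ where $\langle \zeta_{t-1}-\zeta_t\rangle$ is the ideal of $k[\zeta_0,\ldots,\zeta_t]$ generated by 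$\zeta_{t-1}-\zeta_t$.
   Context: The toric ideals are the kernels of the corresponding monomial maps: $\mathcal{I}(A)=\ker\phi$ and $\mathcal{I}(\tilde A)=\ker\psi$, both ideals of $k[p_1,\ldots,p_{IJ}]$. *)

theory Defs
  imports
    "HOL-Library.Poly_Mapping"
    "HOL-Algebra.RingHom"
    "HOL-Algebra.Algebraic_Closure_Type"
    "Jordan_Normal_Form.Matrix"
begin

text \<open>
  A monomial is a finitely supported exponent vector \<^typ>\<open>nat \<Rightarrow>\<^sub>0 nat\<close>, and a polynomial a
  finitely supported map from monomials to coefficients; the product on the type is convolution.
  The type has countably many variables; \<open>mpoly_ring V\<close> is the subring of the polynomials
  in the variables with index in \<open>V\<close>.
\<close>

type_synonym 'k mpoly = "(nat \<Rightarrow>\<^sub>0 nat) \<Rightarrow>\<^sub>0 'k"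

definition mpoly_ring :: "nat set \<Rightarrow> 'k::field mpoly ring" where
  "mpoly_ring V =
     ring_of_type_algebra\<lparr>carrier := {f. \<forall>m\<in>Poly_Mapping.keys f. Poly_Mapping.keys m \<subseteq> V}\<rparr>"

definition Const :: "'k::field \<Rightarrow> 'k mpoly" where
  "Const c = Poly_Mapping.single 0 c"

definition Var :: "nat \<Rightarrow> 'k::field mpoly" where
  "Var i = Poly_Mapping.single (Poly_Mapping.single i 1) 1"

definition subst_hom :: "(nat \<Rightarrow> 'k::field mpoly) \<Rightarrow> 'k mpoly \<Rightarrow> 'k mpoly" where
  "subst_hom g f =
     (\<Sum>m\<in>Poly_Mapping.keys f.
        Const (Poly_Mapping.lookup f m) *
        (\<Prod>i\<in>Poly_Mapping.keys m. g i ^ Poly_Mapping.lookup m i))"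

text \<open>
  The variables \<open>p\<^sub>1, \<dots>, p\<^sub>n\<close> have indices \<open>1..n\<close>, while the rows of a matrix are numbered from 0:
  \<open>p\<^sub>i\<close> belongs to the matrix row \<open>i - 1\<close>. The columns and the \<open>\<zeta>\<^sub>j\<close> are both numbered from 0.
\<close>

definition monomial_map :: "nat mat \<Rightarrow> 'k::field mpoly \<Rightarrow> 'k mpoly" where
  "monomial_map M = subst_hom (\<lambda>i. \<Prod>j<dim_col M. Var j ^ (M $$ (i - 1, j)))"

definition toric_ideal :: "nat mat \<Rightarrow> 'k::field mpoly set" where
  "toric_ideal M =
     a_kernel (mpoly_ring {1..dim_row M}) (mpoly_ring {..<dim_col M}) (monomial_map M)"

definition A_mat :: "nat \<Rightarrow> nat \<Rightarrow> (nat \<Rightarrow> nat \<Rightarrow> nat) \<Rightarrow> nat mat" where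
  "A_mat n t a = mat n (t + 1) (\<lambda>(i, j). if j = 0 then 1 else a (i + 1) j)"

definition A_tilde_mat :: "nat \<Rightarrow> nat \<Rightarrow> (nat \<Rightarrow> nat \<Rightarrow> nat) \<Rightarrow> nat mat" where
  "A_tilde_mat n t a =
     mat n t (\<lambda>(i, j). if j = 0 then 1
                       else if j = t - 1 then a (i + 1) (t - 1) + a (i + 1) t
                       else a (i + 1) j)"

definition phi :: "nat \<Rightarrow> (nat \<Rightarrow> nat \<Rightarrow> nat) \<Rightarrow> 'k::field mpoly \<Rightarrow> 'k mpoly" where
  "phi t a = subst_hom (\<lambda>i. Var 0 * (\<Prod>r=1..t. Var r ^ a i r))"

definition psi :: "nat \<Rightarrow> (nat \<Rightarrow> nat \<Rightarrow> nat) \<Rightarrow> 'k::field mpoly \<Rightarrow> 'k mpoly" where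
  "psi t a =
     subst_hom (\<lambda>i. Var 0 * (\<Prod>r=1..t-2. Var r ^ a i r) * Var (t - 1) ^ (a i (t - 1) + a i t))"

definition alpha :: "nat \<Rightarrow> 'k::field mpoly \<Rightarrow> 'k mpoly" where
  "alpha t = subst_hom (\<lambda>i. if i = t then Var (t - 1) else Var i)"

lemma mpoly_ring_simps [simp]:
  "carrier (mpoly_ring V) = {f. \<forall>m\<in>Poly_Mapping.keys f. Poly_Mapping.keys m \<subseteq> V}"
  "x \<oplus>\<^bsub>mpoly_ring V\<^esub> y = x + y"
  "x \<otimes>\<^bsub>mpoly_ring V\<^esub> y = x * y"
  "\<zero>\<^bsub>mpoly_ring V\<^esub> = 0"
  "\<one>\<^bsub>mpoly_ring V\<^esub> = 1"
  by (simp_all add: mpoly_ring_def ring_of_type_algebra_def)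

lemma mpoly_carrier_add:
  "f \<in> carrier (mpoly_ring V) \<Longrightarrow> g \<in> carrier (mpoly_ring V) \<Longrightarrow> f + g \<in> carrier (mpoly_ring V)"
  using keys_add[of f g] by auto

lemma mpoly_carrier_mult:
  assumes "f \<in> carrier (mpoly_ring V)" "g \<in> carrier (mpoly_ring V)"
  shows "f * g \<in> carrier (mpoly_ring V)"
proof -
  have "Poly_Mapping.keys m \<subseteq> V" if m: "m \<in> Poly_Mapping.keys (f * g)" for m
  proof -
    obtain u v where "m = u + v" "u \<in> Poly_Mapping.keys f" "v \<in> Poly_Mapping.keys g"
      using subsetD[OF keys_mult m] by auto
    moreover from this have "Poly_Mapping.keys u \<subseteq> V" "Poly_Mapping.keys v \<subseteq> V"
      using assms by simp_all
    ultimately show ?thesis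
      using keys_add[of u v] by blast
  qed
  then show ?thesis by auto
qed

lemma mpoly_carrier_0: "0 \<in> carrier (mpoly_ring V)"
  and mpoly_carrier_1: "1 \<in> carrier (mpoly_ring V)"
  by auto

lemma mpoly_carrier_uminus:
  "f \<in> carrier (mpoly_ring V) \<Longrightarrow> - f \<in> carrier (mpoly_ring V)"
  by (auto simp: in_keys_iff)

lemma mpoly_carrier_Const: "Const c \<in> carrier (mpoly_ring V)"
  by (auto simp: Const_def)

lemma mpoly_carrier_Var: "i \<in> V \<Longrightarrow> Var i \<in> carrier (mpoly_ring V)"
  by (auto simp: Var_def)

lemma mpoly_carrier_sum:
  "(\<And>x. x \<in> A \<Longrightarrow> h x \<in> carrier (mpoly_ring V)) \<Longrightarrow> sum h A \<in> carrier (mpoly_ring V)"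
  by (induction A rule: infinite_finite_induct)
    (auto intro!: mpoly_carrier_add mpoly_carrier_0 simp del: mpoly_ring_simps)

lemma mpoly_carrier_prod:
  "(\<And>x. x \<in> A \<Longrightarrow> h x \<in> carrier (mpoly_ring V)) \<Longrightarrow> prod h A \<in> carrier (mpoly_ring V)"
  by (induction A rule: infinite_finite_induct)
    (auto intro!: mpoly_carrier_mult mpoly_carrier_1 simp del: mpoly_ring_simps)

lemma mpoly_carrier_power:
  "f \<in> carrier (mpoly_ring V) \<Longrightarrow> f ^ n \<in> carrier (mpoly_ring V)"
  by (induction n)
    (auto intro!: mpoly_carrier_mult mpoly_carrier_1 simp del: mpoly_ring_simps)

lemmas mpoly_carrier_intros =
  mpoly_carrier_add mpoly_carrier_mult mpoly_carrier_0 mpoly_carrier_1 mpoly_carrier_uminus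
  mpoly_carrier_Const mpoly_carrier_Var mpoly_carrier_sum mpoly_carrier_prod mpoly_carrier_power

lemma cring_mpoly_ring: "cring (mpoly_ring V :: 'a::field mpoly ring)"
proof (rule cringI)
  show "abelian_group (mpoly_ring V :: 'a mpoly ring)"
  proof (rule abelian_groupI)
    fix x :: "'a mpoly"
    assume "x \<in> carrier (mpoly_ring V)"
    then have "- x \<in> carrier (mpoly_ring V)" "- x \<oplus>\<^bsub>mpoly_ring V\<^esub> x = \<zero>\<^bsub>mpoly_ring V\<^esub>"
      using mpoly_carrier_uminus by auto
    then show "\<exists>y\<in>carrier (mpoly_ring V). y \<oplus>\<^bsub>mpoly_ring V\<^esub> x = \<zero>\<^bsub>mpoly_ring V\<^esub>"
      by blast
  next
    fix x y :: "'a mpoly"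
    assume "x \<in> carrier (mpoly_ring V)" "y \<in> carrier (mpoly_ring V)"
    then show "x \<oplus>\<^bsub>mpoly_ring V\<^esub> y \<in> carrier (mpoly_ring V)"
      using mpoly_carrier_add[of x V y] by simp
  qed (auto simp: algebra_simps)
  show "Group.comm_monoid (mpoly_ring V :: 'a mpoly ring)"
  proof (rule comm_monoidI)
    fix x y :: "'a mpoly"
    assume "x \<in> carrier (mpoly_ring V)" "y \<in> carrier (mpoly_ring V)"
    then show "x \<otimes>\<^bsub>mpoly_ring V\<^esub> y \<in> carrier (mpoly_ring V)"
      using mpoly_carrier_mult[of x V y] by simp
  qed (auto simp: algebra_simps)
qed (auto simp: algebra_simps)

lemma subst_hom_superset:
  assumes "finite S" "Poly_Mapping.keys f \<subseteq> S"
  shows "subst_hom g f =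
    (\<Sum>m\<in>S. Const (Poly_Mapping.lookup f m) *
        (\<Prod>i\<in>Poly_Mapping.keys m. g i ^ Poly_Mapping.lookup m i))"
  unfolding subst_hom_def
  by (rule sum.mono_neutral_left) (use assms in \<open>auto simp: Const_def in_keys_iff\<close>)

lemma subst_hom_add: "subst_hom g (f + h) = subst_hom g f + subst_hom g h"
proof -
  let ?S = "Poly_Mapping.keys f \<union> Poly_Mapping.keys h"
  have "Poly_Mapping.keys (f + h) \<subseteq> ?S" by (rule keys_add)
  then show ?thesis
    by (simp add: subst_hom_superset[where S = ?S] sum.distrib[symmetric] lookup_add Const_def
        single_add algebra_simps)
qed

lemma subst_hom_0: "subst_hom g 0 = 0"
  by (simp add: subst_hom_def)

lemma subst_hom_sum: "subst_hom g (sum h A) = (\<Sum>x\<in>A. subst_hom g (h x))"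
  by (induction A rule: infinite_finite_induct) (auto simp: subst_hom_0 subst_hom_add)

lemma subst_hom_single:
  "subst_hom g (Poly_Mapping.single m c) =
     Const c * (\<Prod>i\<in>Poly_Mapping.keys m. g i ^ Poly_Mapping.lookup m i)"
  by (subst subst_hom_superset[where S = "{m}"]) (auto simp: in_keys_iff lookup_single)

lemma subst_hom_Const: "subst_hom g (Const c) = Const c"
  by (simp add: Const_def[of c] subst_hom_single)

lemma subst_hom_Var: "subst_hom g (Var i) = g i"
  by (simp add: Var_def subst_hom_single) (simp add: Const_def)

lemma mpoly_expansion:
  fixes f :: "'k::field mpoly"
  shows "f = (\<Sum>m\<in>Poly_Mapping.keys f. Poly_Mapping.single m (Poly_Mapping.lookup f m))"
  by (rule poly_mapping_eqI)
    (auto simp: lookup_sum lookup_single when_def in_keys_iff)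

lemma monomial_value_add:
  fixes g :: "nat \<Rightarrow> 'k::field mpoly" and m n :: "nat \<Rightarrow>\<^sub>0 nat"
  shows "(\<Prod>i\<in>Poly_Mapping.keys (m + n). g i ^ Poly_Mapping.lookup (m + n) i) =
     (\<Prod>i\<in>Poly_Mapping.keys m. g i ^ Poly_Mapping.lookup m i) *
     (\<Prod>i\<in>Poly_Mapping.keys n. g i ^ Poly_Mapping.lookup n i)"
proof -
  let ?S = "Poly_Mapping.keys m \<union> Poly_Mapping.keys n"
  have *: "(\<Prod>i\<in>Poly_Mapping.keys u. g i ^ Poly_Mapping.lookup u i) =
      (\<Prod>i\<in>?S. g i ^ Poly_Mapping.lookup u i)" if "Poly_Mapping.keys u \<subseteq> ?S" for u
    by (rule prod.mono_neutral_left) (use that in \<open>auto simp: in_keys_iff\<close>)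
  show ?thesis
    using *[of m] *[of n] *[OF keys_add[of m n]]
    by (simp add: lookup_add power_add prod.distrib)
qed

lemma subst_hom_mult: "subst_hom g (f * h) = subst_hom g f * subst_hom g h"
proof -
  have single: "subst_hom g (Poly_Mapping.single m c * Poly_Mapping.single n d) =
      subst_hom g (Poly_Mapping.single m c) * subst_hom g (Poly_Mapping.single n d)" for m n c d
    by (simp add: mult_single subst_hom_single monomial_value_add)
      (simp add: Const_def mult_single[of 0 c 0 d, simplified, symmetric] algebra_simps)
  have "subst_hom g (f * h) =
      subst_hom g ((\<Sum>m\<in>Poly_Mapping.keys f. Poly_Mapping.single m (Poly_Mapping.lookup f m)) *
        (\<Sum>m\<in>Poly_Mapping.keys h. Poly_Mapping.single m (Poly_Mapping.lookup h m)))"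
    using mpoly_expansion[of f] mpoly_expansion[of h] by simp
  also have "\<dots> =
      subst_hom g (\<Sum>m\<in>Poly_Mapping.keys f. Poly_Mapping.single m (Poly_Mapping.lookup f m)) *
      subst_hom g (\<Sum>m\<in>Poly_Mapping.keys h. Poly_Mapping.single m (Poly_Mapping.lookup h m))"
    by (simp add: sum_product subst_hom_sum single)
  also have "\<dots> = subst_hom g f * subst_hom g h"
    using mpoly_expansion[of f] mpoly_expansion[of h] by simp
  finally show ?thesis .
qed

lemma subst_hom_1: "subst_hom g 1 = 1"
  using subst_hom_Const[of g 1] by (simp add: Const_def)

lemma subst_hom_ring_hom:
  assumes "\<And>i. i \<in> V \<Longrightarrow> g i \<in> carrier (mpoly_ring W)"
  shows "subst_hom g \<in> Ring.ring_hom (mpoly_ring V) (mpoly_ring W)"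
proof (rule ring_hom_memI)
  fix f assume f: "f \<in> carrier (mpoly_ring V :: 'a mpoly ring)"
  show "subst_hom g f \<in> carrier (mpoly_ring W)"
    unfolding subst_hom_def
    by (intro mpoly_carrier_intros assms) (use f in auto)
qed (simp_all add: subst_hom_add subst_hom_mult subst_hom_1)

lemma subst_hom_cong:
  assumes "f \<in> carrier (mpoly_ring V)" "\<And>i. i \<in> V \<Longrightarrow> g i = h i"
  shows "subst_hom g f = subst_hom h f"
  unfolding subst_hom_def
  by (intro sum.cong prod.cong arg_cong2[where f = "(*)"] arg_cong2[where f = "(^)"] refl)
    (use assms in auto)

lemma phi_Const: "phi t a (Const c) = Const c"
  and phi_Var: "phi t a (Var i) = Var 0 * (\<Prod>r=1..t. Var r ^ a i r)"
  and psi_Const: "psi t a (Const c) = Const c"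
  and psi_Var: "psi t a (Var i) =
    Var 0 * (\<Prod>r=1..t-2. Var r ^ a i r) * Var (t - 1) ^ (a i (t - 1) + a i t)"
  and alpha_Const: "alpha t (Const c) = Const c"
  and alpha_Var: "i \<noteq> t \<Longrightarrow> alpha t (Var i) = Var i" "alpha t (Var t) = Var (t - 1)"
  by (simp_all add: phi_def psi_def alpha_def subst_hom_Const subst_hom_Var)

lemma phi_ring_hom: "phi t a \<in> Ring.ring_hom (mpoly_ring V) (mpoly_ring {0..t})"
  unfolding phi_def by (intro subst_hom_ring_hom mpoly_carrier_intros) auto

lemma psi_ring_hom:
  "t \<ge> 2 \<Longrightarrow> psi t a \<in> Ring.ring_hom (mpoly_ring V) (mpoly_ring {0..t-1})"
  unfolding psi_def by (intro subst_hom_ring_hom mpoly_carrier_intros) auto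

lemma alpha_ring_hom:
  "t \<ge> 2 \<Longrightarrow> alpha t \<in> Ring.ring_hom (mpoly_ring {0..t}) (mpoly_ring {0..t-1})"
  unfolding alpha_def
  by (intro subst_hom_ring_hom) (auto simp del: mpoly_ring_simps intro!: mpoly_carrier_Var)

lemma toric_ideal_A_mat:
  "toric_ideal (A_mat n t a) = a_kernel (mpoly_ring {1..n}) (mpoly_ring {0..t}) (phi t a)"
proof -
  have "monomial_map (A_mat n t a) f = phi t a f"
    if "f \<in> carrier (mpoly_ring {1..n})" for f :: "'a mpoly"
    unfolding monomial_map_def phi_def
  proof (rule subst_hom_cong[OF that])
    fix i assume i: "i \<in> {1..n}"
    have "(\<Prod>j<t + 1. Var j ^ (A_mat n t a $$ (i - 1, j))) =
        (\<Prod>j\<in>insert 0 {1..t}. (Var j :: 'a mpoly) ^ (if j = 0 then 1 else a i j))"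
      by (rule prod.cong) (use i in \<open>auto simp: A_mat_def\<close>)
    also have "\<dots> = Var 0 * (\<Prod>r=1..t. Var r ^ a i r)"
      by simp
    finally show "(\<Prod>j<dim_col (A_mat n t a). Var j ^ (A_mat n t a $$ (i - 1, j))) =
        (Var 0 * (\<Prod>r=1..t. Var r ^ a i r) :: 'a mpoly)"
      by (simp add: A_mat_def)
  qed
  moreover have "dim_row (A_mat n t a) = n"
    by (simp add: A_mat_def)
  ultimately show ?thesis
    unfolding toric_ideal_def a_kernel_def' by (auto simp del: mpoly_ring_simps(1))
qed

lemma toric_ideal_A_tilde_mat:
  assumes t: "t \<ge> 2"
  shows "toric_ideal (A_tilde_mat n t a) =
    a_kernel (mpoly_ring {1..n}) (mpoly_ring {0..t-1}) (psi t a)"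
proof -
  have "monomial_map (A_tilde_mat n t a) f = psi t a f"
    if "f \<in> carrier (mpoly_ring {1..n})" for f :: "'a mpoly"
    unfolding monomial_map_def psi_def
  proof (rule subst_hom_cong[OF that])
    fix i assume i: "i \<in> {1..n}"
    have "(\<Prod>j<t. Var j ^ (A_tilde_mat n t a $$ (i - 1, j))) =
        (\<Prod>j\<in>insert 0 (insert (t - 1) {1..t-2}). (Var j :: 'a mpoly) ^
           (if j = 0 then 1 else if j = t - 1 then a i (t - 1) + a i t else a i j))"
      by (rule prod.cong) (use i t in \<open>auto simp: A_tilde_mat_def\<close>)
    also have "\<dots> = Var 0 * (Var (t - 1) ^ (a i (t - 1) + a i t) *
        (\<Prod>j\<in>{1..t-2}. (Var j :: 'a mpoly) ^
           (if j = 0 then 1 else if j = t - 1 then a i (t - 1) + a i t else a i j)))"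
      using t by (simp add: not_le)
    also have "(\<Prod>j\<in>{1..t-2}. (Var j :: 'a mpoly) ^
           (if j = 0 then 1 else if j = t - 1 then a i (t - 1) + a i t else a i j)) =
        (\<Prod>r=1..t-2. Var r ^ a i r)"
      by (rule prod.cong) (use t in auto)
    finally show "(\<Prod>j<dim_col (A_tilde_mat n t a). Var j ^ (A_tilde_mat n t a $$ (i - 1, j))) =
        (Var 0 * (\<Prod>r=1..t-2. Var r ^ a i r) * Var (t - 1) ^ (a i (t - 1) + a i t) :: 'a mpoly)"
      by (simp add: A_tilde_mat_def mult_ac)
  qed
  moreover have "dim_row (A_tilde_mat n t a) = n"
    by (simp add: A_tilde_mat_def)
  ultimately show ?thesis
    unfolding toric_ideal_def a_kernel_def' by (auto simp del: mpoly_ring_simps(1))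
qed

end

theory Submission
  imports Defs
begin

text \<open>
  Since \<open>\<psi> = \<alpha> \<circ> \<phi>\<close>, the kernel of \<open>\<psi>\<close> is the preimage of \<open>ker \<alpha>\<close> under \<open>\<phi>\<close>, so everything
  rests on \<open>ker \<alpha> = \<langle>\<zeta>\<^bsub>t-1\<^esub> - \<zeta>\<^sub>t\<rangle>\<close>. The generator clearly lies in the kernel. Conversely, \<open>\<alpha>\<close> moves
  each variable only within its residue class modulo the ideal of the generator, and substitution
  respects congruences (\<open>subst_hom_diff_in_ideal\<close>), so \<open>f - \<alpha> f\<close> lies in that ideal for every
  \<open>f\<close>; if \<open>\<alpha> f = 0\<close>, this difference is \<open>f\<close> itself.

  Thus \<open>\<phi>\<^sup>-\<^sup>1(\<langle>\<zeta>\<^bsub>t-1\<^esub> - \<zeta>\<^sub>t\<rangle>)\<close> is already all of \<open>ker \<psi>\<close>. It contains \<open>ker \<phi>\<close>, so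
  adding \<open>ker \<phi>\<close> to it changes nothing, and this is the asserted equation.
\<close>

lemma subst_hom_prod: "subst_hom g (prod h A) = (\<Prod>x\<in>A. subst_hom g (h x))"
  by (induction A rule: infinite_finite_induct) (auto simp: subst_hom_1 subst_hom_mult)

lemma subst_hom_power: "subst_hom g (f ^ n) = subst_hom g f ^ n"
  by (induction n) (auto simp: subst_hom_1 subst_hom_mult)

lemmas subst_hom_simps =
  subst_hom_mult subst_hom_prod subst_hom_power subst_hom_Const subst_hom_Var

lemma subst_hom_subst_hom:
  "subst_hom h (subst_hom g f) = subst_hom (\<lambda>i. subst_hom h (g i)) f"
  unfolding subst_hom_def[of g f] subst_hom_def[of "\<lambda>i. subst_hom h (g i)" f]
  by (simp add: subst_hom_sum subst_hom_simps)

lemma prod_Var_power_keys: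
  "(\<Prod>i\<in>Poly_Mapping.keys m. Var i ^ Poly_Mapping.lookup m i) =
     (Poly_Mapping.single m 1 :: 'k::field mpoly)"
proof -
  have pow: "(Var i ^ n :: 'k mpoly) = Poly_Mapping.single (Poly_Mapping.single i n) 1" for i n
    by (induction n) (simp_all add: Var_def mult_single single_add[symmetric])
  have prod: "(\<Prod>i\<in>S. Poly_Mapping.single (u i) 1) =
      (Poly_Mapping.single (sum u S) 1 :: 'k mpoly)" for S :: "nat set" and u
    by (induction S rule: infinite_finite_induct) (simp_all add: mult_single)
  have "(\<Sum>i\<in>Poly_Mapping.keys m. Poly_Mapping.single i (Poly_Mapping.lookup m i)) = m"
    by (rule poly_mapping_eqI) (auto simp: lookup_sum lookup_single when_def in_keys_iff)
  then show ?thesis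
    by (simp add: pow prod)
qed

lemma subst_hom_Var_id: "subst_hom Var f = f"
  unfolding subst_hom_def prod_Var_power_keys Const_def
  by (simp add: mult_single) (rule mpoly_expansion[symmetric])

lemma
  assumes "ideal K (mpoly_ring W)"
  shows zero_in_ideal: "0 \<in> K"
    and add_in_ideal: "x \<in> K \<Longrightarrow> y \<in> K \<Longrightarrow> x + y \<in> K"
    and mult_in_ideal: "x \<in> K \<Longrightarrow> y \<in> carrier (mpoly_ring W) \<Longrightarrow> y * x \<in> K"
  using additive_subgroup.zero_closed[OF ideal.axioms(1)[OF assms]]
    additive_subgroup.a_closed[OF ideal.axioms(1)[OF assms], of x y]
    ideal.I_l_closed[OF assms, of x y]
  by (simp_all del: mpoly_ring_simps(1))

text \<open>
  Congruence modulo \<open>K\<close> is compatible with products because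
  \<open>x y - x' y' = x (y - y') + y' (x - x')\<close>.
\<close>

lemma diff_in_ideal_mult:
  assumes K: "ideal K (mpoly_ring W)"
    and xy: "x \<in> carrier (mpoly_ring W)" "y' \<in> carrier (mpoly_ring W)"
    and d: "x - x' \<in> K" "y - y' \<in> K"
  shows "x * y - x' * y' \<in> K"
proof -
  have "x * (y - y') + y' * (x - x') \<in> K"
    by (intro add_in_ideal[OF K] mult_in_ideal[OF K] d xy)
  then show ?thesis
    by (simp add: algebra_simps)
qed

lemma diff_in_ideal_power:
  assumes K: "ideal K (mpoly_ring W)"
    and xy: "x \<in> carrier (mpoly_ring W)" "y \<in> carrier (mpoly_ring W)" "x - y \<in> K"
  shows "x ^ n - y ^ n \<in> K"
proof (induction n)
  case (Suc n)
  show ?case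
    unfolding power_Suc
    by (rule diff_in_ideal_mult[OF K xy(1) mpoly_carrier_power[OF xy(2)] xy(3) Suc])
qed (simp add: zero_in_ideal[OF K])

lemma diff_in_ideal_prod:
  assumes K: "ideal K (mpoly_ring W)"
    and "\<And>i. i \<in> S \<Longrightarrow> u i \<in> carrier (mpoly_ring W)"
    and "\<And>i. i \<in> S \<Longrightarrow> v i \<in> carrier (mpoly_ring W)"
    and "\<And>i. i \<in> S \<Longrightarrow> u i - v i \<in> K"
  shows "prod u S - prod v S \<in> K"
  using assms(2-4)
proof (induction S rule: infinite_finite_induct)
  case (insert i S)
  have "u i * prod u S - v i * prod v S \<in> K"
    by (rule diff_in_ideal_mult[OF K]) (use insert in \<open>blast intro: mpoly_carrier_prod\<close>)+
  then show ?case
    using insert.hyps by simp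
qed (simp_all add: zero_in_ideal[OF K])

text \<open>
  Substitution descends to the quotient by an ideal: its value modulo \<open>K\<close> depends only on the
  residue classes of the substituted polynomials.
\<close>

lemma subst_hom_diff_in_ideal:
  assumes K: "ideal K (mpoly_ring W)"
    and f: "f \<in> carrier (mpoly_ring V)"
    and g: "\<And>i. i \<in> V \<Longrightarrow> g i \<in> carrier (mpoly_ring W)"
    and h: "\<And>i. i \<in> V \<Longrightarrow> h i \<in> carrier (mpoly_ring W)"
    and gh: "\<And>i. i \<in> V \<Longrightarrow> g i - h i \<in> K"
  shows "subst_hom g f - subst_hom h f \<in> K"
proof -
  have sum_closed: "sum u S \<in> K" if "\<And>m. m \<in> S \<Longrightarrow> u m \<in> K"
    for u :: "(nat \<Rightarrow>\<^sub>0 nat) \<Rightarrow> 'a mpoly" and S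
    using that
  proof (induction S rule: infinite_finite_induct)
    case (insert m S)
    then show ?case
      by (simp add: add_in_ideal[OF K])
  qed (simp_all add: zero_in_ideal[OF K])
  have "Const (Poly_Mapping.lookup f m) *
      ((\<Prod>i\<in>Poly_Mapping.keys m. g i ^ Poly_Mapping.lookup m i) -
       (\<Prod>i\<in>Poly_Mapping.keys m. h i ^ Poly_Mapping.lookup m i)) \<in> K"
    if "m \<in> Poly_Mapping.keys f" for m
  proof -
    have V: "i \<in> V" if "i \<in> Poly_Mapping.keys m" for i
      using f \<open>m \<in> Poly_Mapping.keys f\<close> that by auto
    have "(\<Prod>i\<in>Poly_Mapping.keys m. g i ^ Poly_Mapping.lookup m i) -
       (\<Prod>i\<in>Poly_Mapping.keys m. h i ^ Poly_Mapping.lookup m i) \<in> K"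
      by (intro diff_in_ideal_prod[OF K] diff_in_ideal_power[OF K] mpoly_carrier_power
          g h gh V)
    then show ?thesis
      by (rule mult_in_ideal[OF K _ mpoly_carrier_Const])
  qed
  then show ?thesis
    unfolding subst_hom_def sum_subtractf[symmetric] right_diff_distrib[symmetric]
    by (rule sum_closed)
qed

lemma psi_eq_alpha_phi:
  assumes "t \<ge> 2"
  shows "psi t a f = alpha t (phi t a f)"
proof -
  define b :: "nat \<Rightarrow> 'a mpoly" where "b = (\<lambda>i. if i = t then Var (t - 1) else Var i)"
  have "Var 0 * (\<Prod>r=1..t-2. Var r ^ a i r) * Var (t - 1) ^ (a i (t - 1) + a i t) =
      subst_hom b (Var 0 * (\<Prod>r=1..t. Var r ^ a i r))" for i
  proof -
    have "(\<Prod>r=1..t. b r ^ a i r) =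
        (\<Prod>r\<in>insert t (insert (t - 1) {1..t-2}). b r ^ a i r)"
      by (rule prod.cong) (use assms in auto)
    also have "\<dots> = b t ^ a i t * (b (t - 1) ^ a i (t - 1) * (\<Prod>r=1..t-2. b r ^ a i r))"
      using assms by (simp add: not_le)
    also have "(\<Prod>r=1..t-2. b r ^ a i r) = (\<Prod>r=1..t-2. Var r ^ a i r)"
      by (rule prod.cong) (use assms in \<open>auto simp: b_def\<close>)
    finally show ?thesis
      using assms by (simp add: subst_hom_simps b_def power_add mult_ac)
  qed
  then show ?thesis
    by (simp add: psi_def alpha_def phi_def subst_hom_subst_hom b_def)
qed

lemma ring_mpoly_ring: "Ring.ring (mpoly_ring V)"
  using cring_mpoly_ring cring.axioms(1) by blast

lemma in_a_kernel_mpoly_ring: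
  "f \<in> a_kernel (mpoly_ring V) (mpoly_ring W) h \<longleftrightarrow> f \<in> carrier (mpoly_ring V) \<and> h f = 0"
  by (simp add: a_kernel_def' del: mpoly_ring_simps(1))

lemma ideal_a_kernel_mpoly_ring:
  "h \<in> Ring.ring_hom (mpoly_ring V) (mpoly_ring W) \<Longrightarrow>
    ideal (a_kernel (mpoly_ring V) (mpoly_ring W) h) (mpoly_ring V)"
  by (intro ring_hom_ring.kernel_is_ideal ring_hom_ringI2 ring_mpoly_ring)

text \<open>
  The identity and \<open>\<alpha>\<close> are substitutions that agree on all variables but \<open>\<zeta>\<^sub>t\<close>, where they differ
  by the generator up to sign. Hence \<open>f - \<alpha> f\<close> lies in the ideal for every \<open>f\<close>, in particular \<open>f\<close>
  itself does if \<open>\<alpha> f = 0\<close>.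
\<close>

lemma kernel_alpha:
  assumes t: "t \<ge> 2"
  shows "a_kernel (mpoly_ring {0..t}) (mpoly_ring {0..t-1}) (alpha t) =
    Idl\<^bsub>mpoly_ring {0..t}\<^esub> {Var (t - 1) - Var t :: 'k::field mpoly}"
proof
  let ?R = "mpoly_ring {0..t} :: 'k mpoly ring" and ?d = "Var (t - 1) - Var t :: 'k mpoly"
  let ?K = "Idl\<^bsub>?R\<^esub> {?d}"
  have vars: "Var i \<in> carrier ?R" if "i \<le> t" for i
    using that by (intro mpoly_carrier_Var) simp
  have d: "?d \<in> carrier ?R"
    using mpoly_carrier_add[OF vars[of "t - 1"] mpoly_carrier_uminus[OF vars[of t]]]
    by (simp del: mpoly_ring_simps)
  have K: "ideal ?K ?R" and dK: "?d \<in> ?K"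
    using ring.genideal_ideal[OF ring_mpoly_ring, of "{?d}" "{0..t}"]
      ring.genideal_self'[OF ring_mpoly_ring d] d
    by blast+
  have minus_dK: "Var t - Var (t - 1) \<in> ?K"
    using mult_in_ideal[OF K dK mpoly_carrier_uminus[OF mpoly_carrier_1]]
    by simp
  show "a_kernel ?R (mpoly_ring {0..t-1}) (alpha t) \<subseteq> ?K"
  proof
    fix f assume "f \<in> a_kernel ?R (mpoly_ring {0..t-1}) (alpha t)"
    then have f: "f \<in> carrier ?R" and "alpha t f = 0"
      by (simp_all only: in_a_kernel_mpoly_ring)
    moreover have "subst_hom Var f - alpha t f \<in> ?K"
      unfolding alpha_def
    proof (rule subst_hom_diff_in_ideal[OF K f])
      fix i assume "i \<in> {0..t}"
      then show "Var i \<in> carrier ?R" "(if i = t then Var (t - 1) else Var i) \<in> carrier ?R"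
        using vars[of i] vars[of "t - 1"] by simp_all
      show "Var i - (if i = t then Var (t - 1) else Var i) \<in> ?K"
        using minus_dK zero_in_ideal[OF K] by (cases "i = t") simp_all
    qed
    ultimately show "f \<in> ?K"
      by (simp add: subst_hom_Var_id)
  qed
  \<comment> \<open>\<open>?d + Var t\<close> is \<open>Var (t - 1)\<close>, which has the same image as \<open>Var t\<close>.\<close>
  have "alpha t (?d + Var t) = alpha t ?d + alpha t (Var t)"
    by (simp only: alpha_def subst_hom_add)
  then have "alpha t ?d = 0"
    using t by (simp add: alpha_Var)
  then have "{?d} \<subseteq> a_kernel ?R (mpoly_ring {0..t-1}) (alpha t)"
    using d in_a_kernel_mpoly_ring by blast
  then show "?K \<subseteq> a_kernel ?R (mpoly_ring {0..t-1}) (alpha t)"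
    by (rule ring.genideal_minimal[OF ring_mpoly_ring
          ideal_a_kernel_mpoly_ring[OF alpha_ring_hom[OF t]]])
qed

theorem theorem9:
  fixes I J t :: nat and a :: "nat \<Rightarrow> nat \<Rightarrow> nat"
  assumes "I \<ge> 1" and "J \<ge> 1" and "t \<ge> 2"
  shows "(\<forall>f \<in> carrier (mpoly_ring {1..I * J} :: 'k::field mpoly ring).
            psi t a f = alpha t (phi t a f)) \<and>
         (toric_ideal (A_tilde_mat (I * J) t a) :: 'k mpoly set) =
           toric_ideal (A_mat (I * J) t a)
           <+>\<^bsub>mpoly_ring {1..I * J}\<^esub>
           {f \<in> carrier (mpoly_ring {1..I * J}).
              phi t a f \<in> Idl\<^bsub>mpoly_ring {0..t}\<^esub> {Var (t - 1) - Var t}}"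
proof (intro conjI ballI)
  let ?P = "mpoly_ring {1..I * J} :: 'k mpoly ring"
  let ?B = "{f \<in> carrier ?P. phi t a f \<in> Idl\<^bsub>mpoly_ring {0..t}\<^esub> {Var (t - 1) - Var t}}"
  show "psi t a f = alpha t (phi t a f)" for f :: "'k mpoly"
    by (rule psi_eq_alpha_phi[OF \<open>t \<ge> 2\<close>])
  have phi_closed: "phi t a f \<in> carrier (mpoly_ring {0..t})" if "f \<in> carrier ?P" for f
    by (rule ring_hom_closed[OF phi_ring_hom that])
  have ker_psi: "toric_ideal (A_tilde_mat (I * J) t a) = ?B"
    unfolding toric_ideal_A_tilde_mat[OF \<open>t \<ge> 2\<close>] kernel_alpha[OF \<open>t \<ge> 2\<close>, symmetric]
    by (auto simp: in_a_kernel_mpoly_ring psi_eq_alpha_phi[OF \<open>t \<ge> 2\<close>] phi_closed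
        simp del: mpoly_ring_simps(1))
  have B: "ideal ?B ?P"
    unfolding ker_psi[symmetric] toric_ideal_A_tilde_mat[OF \<open>t \<ge> 2\<close>]
    by (rule ideal_a_kernel_mpoly_ring[OF psi_ring_hom[OF \<open>t \<ge> 2\<close>]])
  have "alpha t 0 = 0"
    by (simp add: alpha_def subst_hom_0)
  then have A_sub: "toric_ideal (A_mat (I * J) t a) \<subseteq> ?B"
    unfolding ker_psi[symmetric] toric_ideal_A_tilde_mat[OF \<open>t \<ge> 2\<close>] toric_ideal_A_mat
    by (auto simp: in_a_kernel_mpoly_ring psi_eq_alpha_phi[OF \<open>t \<ge> 2\<close>] simp del: mpoly_ring_simps(1))
  have zero_A: "0 \<in> toric_ideal (A_mat (I * J) t a)"
    by (simp add: toric_ideal_A_mat in_a_kernel_mpoly_ring phi_def subst_hom_0)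
  have "toric_ideal (A_mat (I * J) t a) <+>\<^bsub>?P\<^esub> ?B = ?B"
  proof
    show "toric_ideal (A_mat (I * J) t a) <+>\<^bsub>?P\<^esub> ?B \<subseteq> ?B"
    proof
      fix z assume "z \<in> toric_ideal (A_mat (I * J) t a) <+>\<^bsub>?P\<^esub> ?B"
      then obtain x y where "x \<in> toric_ideal (A_mat (I * J) t a)" "y \<in> ?B" "z = x + y"
        by (auto simp: set_add_def' simp del: mpoly_ring_simps(1))
      then show "z \<in> ?B"
        using add_in_ideal[OF B] A_sub by blast
    qed
    show "?B \<subseteq> toric_ideal (A_mat (I * J) t a) <+>\<^bsub>?P\<^esub> ?B"
    proof
      fix y assume "y \<in> ?B"
      then show "y \<in> toric_ideal (A_mat (I * J) t a) <+>\<^bsub>?P\<^esub> ?B"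
        unfolding set_add_def' using zero_A by (intro UN_I[of 0] UN_I[of y]) simp_all
    qed
  qed
  then show "toric_ideal (A_tilde_mat (I * J) t a) =
      toric_ideal (A_mat (I * J) t a) <+>\<^bsub>?P\<^esub> ?B"
    by (simp only: ker_psi)
qed

end
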